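(* Let $D$ be an n-atomic domain. (1) If $D$ is an n-UFD, then for every $x\in D^{\#}$ one has $S(x)=(A,P(A))$ for some $A\subseteq \overline{Irr}(x)$, where $P(A)$ is the power set of $A$. (2) Suppose that $D$ satisfies the following condition: whenever $a,r,r'$ are normal irreducible elements of $D$ with $ar=r'a$, then $r$ and $r'$ are associated. If for every $x\in D^{\#}$ one has $S(x)=(A,P(A))$ for some $A\subseteq\overline{Irr}(x)$, then $D$ is an n-UFD. (Loops are ignored in the equalities $S(x)=(A,P(A))$.)
   Context: A domain is an associative ring with identity, not necessarily commutative, without zero divisors. $U(D)$ is the group of units, $D^{*}=D\setminus\{0\}$, $D^{\#}=D^{*}\setminus U(D)$. An element is irreducible if it is a nonzero nonunit that is not a product of two nonunits; $Irr(D)$ is the set of irreducible elements, and $\overline{Irr}(D)$ is a fixed set of representatives, one from each coset in $\{aU(D):a\in Irr(D)\}$. $a\mid b$ means $b=cad$ for some $c,d\in D$. Elements $a,b$ are associated if $a=vbu$ with $u,v\in U(D)$. An element $a$ is normal if $aD=Da$. $D$ is n-atomic if every $r\in D^{\#}$ is a product of normal irreducible elements. $D$ is an n-UFD if it is n-atomic and, whenever $r_1\cdots r_l=t_1\cdots t_m$ is an element of $D^{\#}$ with all $r_i,t_j$ normal irreducible, then $l=m$ and there is a permutation $\sigma\in S_l$ with $r_i$ associated with $t_{\sigma(i)}$ for all $i$. For $x\in D^{\#}$, $\overline{Irr}(x)=\{y\in\overline{Irr}(D): y\mid x\}$. The irreducible divisor simplicial complex $S(x)$ is the pair $(V,F)$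 with vertex set $V=\{y\in\overline{Irr}(D):y\mid x\}$ and face set $F$ consisting of $\emptyset$ and all sets $\{y_1,\dots,y_n\}$ of distinct vertices such that $y_{\sigma(1)}y_{\sigma(2)}\cdots y_{\sigma(n)}\mid x$ for some permutation $\sigma\in S_n$. (In addition $n-1$ loops are placed on a vertex $y$ if $y^n\mid x$ but $y^{n+1}\nmid x$.) *)

theory Defs
  imports Main "HOL-Combinatorics.Permutations"
begin

text \<open>
  The domain \<open>D\<close> is a type of class \<open>ring_1_no_zero_divisors\<close>, whose multiplication need not
  commute. The library's \<open>dvd\<close>, \<open>is_unit\<close> and \<open>irreducible\<close> are one-sided or restricted to
  commutative structures, so the two-sided notions are defined here.
\<close>

definition unit_elems :: "'a::ring_1_no_zero_divisors set" where
  "unit_elems = {u. \<exists>v. u * v = 1 \<and> v * u = 1}"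

definition nonzero_nonunits :: "'a::ring_1_no_zero_divisors set" where
  "nonzero_nonunits = UNIV - {0} - unit_elems"

definition irreducible_elem :: "'a::ring_1_no_zero_divisors \<Rightarrow> bool" where
  "irreducible_elem a \<longleftrightarrow>
     a \<noteq> 0 \<and> a \<notin> unit_elems \<and>
     \<not> (\<exists>b c. b \<notin> unit_elems \<and> c \<notin> unit_elems \<and> a = b * c)"

definition unit_coset :: "'a::ring_1_no_zero_divisors \<Rightarrow> 'a set" where
  "unit_coset a = (\<lambda>u. a * u) ` unit_elems"

definition irreducible_reps :: "'a::ring_1_no_zero_divisors set \<Rightarrow> bool" where
  "irreducible_reps R \<longleftrightarrow>
     R \<subseteq> (\<Union>a\<in>Collect irreducible_elem. unit_coset a) \<and>
     (\<forall>C \<in> unit_coset ` Collect irreducible_elem. \<exists>!y. y \<in> R \<inter> C)"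

definition divides :: "'a::ring_1_no_zero_divisors \<Rightarrow> 'a \<Rightarrow> bool" where
  "divides a b \<longleftrightarrow> (\<exists>c d. b = c * a * d)"

definition associated_elems :: "'a::ring_1_no_zero_divisors \<Rightarrow> 'a \<Rightarrow> bool" where
  "associated_elems a b \<longleftrightarrow> (\<exists>u\<in>unit_elems. \<exists>v\<in>unit_elems. a = v * b * u)"

definition normal_elem :: "'a::ring_1_no_zero_divisors \<Rightarrow> bool" where
  "normal_elem a \<longleftrightarrow> range (\<lambda>d. a * d) = range (\<lambda>d. d * a)"

definition normal_irreducible :: "'a::ring_1_no_zero_divisors \<Rightarrow> bool" where
  "normal_irreducible a \<longleftrightarrow> normal_elem a \<and> irreducible_elem a"

definition n_atomic :: "'a::ring_1_no_zero_divisors itself \<Rightarrow> bool" where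
  "n_atomic _ \<longleftrightarrow>
     (\<forall>r \<in> (nonzero_nonunits :: 'a set).
        \<exists>rs. (\<forall>a\<in>set rs. normal_irreducible a) \<and> r = prod_list rs)"

definition n_UFD :: "'a::ring_1_no_zero_divisors itself \<Rightarrow> bool" where
  "n_UFD T \<longleftrightarrow>
     n_atomic T \<and>
     (\<forall>rs ts :: 'a list.
        (\<forall>a\<in>set rs. normal_irreducible a) \<and> (\<forall>a\<in>set ts. normal_irreducible a) \<and>
        prod_list rs = prod_list ts \<and> prod_list rs \<in> nonzero_nonunits \<longrightarrow>
        length rs = length ts \<and>
        (\<exists>\<sigma>. \<sigma> permutes {..<length rs} \<and>
             (\<forall>i<length rs. associated_elems (rs ! i) (ts ! \<sigma> i))))"

definition irreducible_divisors ::
  "'a::ring_1_no_zero_divisors set \<Rightarrow> 'a \<Rightarrow> 'a set" where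
  "irreducible_divisors R x = {y \<in> R. divides y x}"

text \<open>
  The irreducible divisor simplicial complex of \<open>x\<close>, as the pair of its vertex set and its face
  set, without the loops at vertices. The parameter \<open>R\<close> is the fixed set of representatives of
  irreducibles.
\<close>

definition irreducible_divisor_complex ::
  "'a::ring_1_no_zero_divisors set \<Rightarrow> 'a \<Rightarrow> 'a set \<times> 'a set set" where
  "irreducible_divisor_complex R x =
     (irreducible_divisors R x,
      insert {} {set ys | ys. distinct ys \<and> set ys \<subseteq> irreducible_divisors R x \<and>
        (\<exists>\<sigma>. \<sigma> permutes {..<length ys} \<and> divides (prod_list (permute_list \<sigma> ys)) x)})"

end

theory Submission
  imports Defs
begin

text \<open>
  In an n-atomic domain every element is normal, so association is \<open>a = b * u\<close> with
  \<open>u\<close> a unit and is a congruence. Both parts go through the same two properties: (P) an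
  irreducible dividing a product of irreducibles is associated with one of the factors, and (C) \<open>a *
  b\<close> is associated with \<open>b * a\<close> for irreducible \<open>a\<close>, \<open>b\<close>. Under
  (C), factorizations behave as in a commutative monoid. An n-UFD satisfies (P), and (P) implies (C), since
  \<open>a * r = r' * a\<close> makes \<open>r\<close> a divisor of \<open>r' * a\<close>; then pairwise
  non-associated irreducible divisors of \<open>x\<close> match distinct factors of \<open>x\<close>, so their
  product divides \<open>x\<close>. Conversely, the hypothesis of (2) is (C). If \<open>t\<close> divides
  \<open>r * s\<close> and is not associated with \<open>r\<close>, then the representatives of
  \<open>r\<close> and \<open>t\<close> form a face, so \<open>r * t\<close> divides \<open>r * s\<close> and
  \<open>t\<close> divides \<open>s\<close>; induction on the number of factors gives (P), and (P) with (C)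
  gives unique factorization.
\<close>

section \<open>Units and irreducible elements\<close>

lemma left_inverse_of_right_inverse:
  fixes a b :: "'a::ring_1_no_zero_divisors"
  assumes "a * b = 1"
  shows "b * a = 1"
proof -
  \<comment> \<open>Here \<open>a * b * a = a\<close>, and \<open>a\<close> can be cancelled because
    there are no zero divisors.\<close>
  have "a * (b * a - 1) = 0"
    using assms by (simp add: algebra_simps flip: mult.assoc)
  moreover have "a \<noteq> 0"
    using assms by auto
  ultimately show ?thesis
    by simp
qed

lemma unit_elems_iff_right: "u \<in> unit_elems \<longleftrightarrow> (\<exists>v. u * v = 1)"
  unfolding unit_elems_def using left_inverse_of_right_inverse by blast

lemma unit_elems_iff_left: "u \<in> unit_elems \<longleftrightarrow> (\<exists>v. v * u = 1)"
  unfolding unit_elems_def using left_inverse_of_right_inverse by blast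

lemma one_in_unit_elems [simp]: "1 \<in> unit_elems"
  by (auto simp: unit_elems_def)

lemma zero_notin_unit_elems [simp]: "0 \<notin> unit_elems"
  by (auto simp: unit_elems_def)

text \<open>A right inverse of the product yields a right inverse of \<open>a\<close>, and a left
  inverse yields a left inverse of \<open>b\<close>. This suffices because one-sided inverses are
  two-sided.\<close>

lemma mult_in_unit_elems_iff [simp]: "a * b \<in> unit_elems \<longleftrightarrow> a \<in> unit_elems \<and> b \<in> unit_elems"
proof (intro iffI conjI)
  assume ab: "a * b \<in> unit_elems"
  then show "a \<in> unit_elems"
    unfolding unit_elems_iff_right by (metis mult.assoc)
  from ab show "b \<in> unit_elems"
    unfolding unit_elems_iff_left by (metis mult.assoc)
next
  assume "a \<in> unit_elems \<and> b \<in> unit_elems"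
  then obtain v w where "a * v = 1" "b * w = 1"
    unfolding unit_elems_iff_right by blast
  then have "(a * b) * (w * v) = 1"
    by (metis mult.assoc mult.right_neutral)
  then show "a * b \<in> unit_elems"
    unfolding unit_elems_iff_right by blast
qed

lemma unit_elems_obtain_inverse:
  assumes "u \<in> unit_elems"
  obtains v where "v \<in> unit_elems" "u * v = 1" "v * u = 1"
  using assms unfolding unit_elems_def by blast

lemma irreducible_elem_nonzero: "irreducible_elem a \<Longrightarrow> a \<noteq> 0"
  by (simp add: irreducible_elem_def)

lemma irreducible_elem_mult_unit:
  assumes "irreducible_elem a" "u \<in> unit_elems"
  shows "irreducible_elem (a * u)"
proof -
  obtain v where v: "v \<in> unit_elems" "u * v = 1"
    using assms(2) by (rule unit_elems_obtain_inverse)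
  have "b \<in> unit_elems \<or> c \<in> unit_elems" if "a * u = b * c" for b c
  proof -
    have "a = b * (c * v)"
      using that v(2) by (metis mult.assoc mult.right_neutral)
    then have "b \<in> unit_elems \<or> c * v \<in> unit_elems"
      using assms(1) unfolding irreducible_elem_def by blast
    then show ?thesis by auto
  qed
  then show ?thesis
    using assms unfolding irreducible_elem_def by auto
qed

lemma prod_list_irreducible_nonzero:
  "(\<And>a. a \<in> set rs \<Longrightarrow> irreducible_elem a) \<Longrightarrow> prod_list rs \<noteq> 0"
  by (induction rs) (auto simp: irreducible_elem_nonzero)

section \<open>Normal elements and n-atomicity\<close>

lemma normal_elem_mult:
  assumes "normal_elem a" "normal_elem b"
  shows "normal_elem (a * b)"
proof -
  \<comment> \<open>The chain is abD = a(bD) = a(Db) = (aD)b = (Da)b = Dab.\<close>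
  have "range (\<lambda>d. a * b * d) = (*) a ` range (\<lambda>d. b * d)"
    by (auto simp: mult.assoc image_image)
  also have "\<dots> = (\<lambda>d. d * b) ` range (\<lambda>d. a * d)"
    using assms(2) by (auto simp: normal_elem_def mult.assoc image_image)
  also have "\<dots> = range (\<lambda>d. d * (a * b))"
    using assms(1) by (auto simp: normal_elem_def mult.assoc image_image)
  finally show ?thesis
    by (simp add: normal_elem_def)
qed

lemma normal_elem_one: "normal_elem 1"
  by (simp add: normal_elem_def)

lemma normal_elem_prod_list:
  "(\<And>a. a \<in> set rs \<Longrightarrow> normal_elem a) \<Longrightarrow> normal_elem (prod_list rs)"
  by (induction rs) (auto simp: normal_elem_one normal_elem_mult)

lemma normal_elem_unit:
  assumes "u \<in> unit_elems"
  shows "normal_elem u"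
proof -
  obtain v where v: "u * v = 1" "v * u = 1"
    using assms by (rule unit_elems_obtain_inverse)
  \<comment> \<open>Both one-sided ideals generated by a unit are the whole ring.\<close>
  have "surj (\<lambda>d. u * d)" "surj (\<lambda>d. d * u)"
    by (rule surjI[where f = "\<lambda>d. v * d"], simp add: v flip: mult.assoc)
       (rule surjI[where f = "\<lambda>d. d * v"], simp add: v mult.assoc)
  then show ?thesis
    by (simp add: normal_elem_def)
qed

text \<open>Zero and units are always normal, and normality passes to products, hence to every
  product of normal irreducibles.\<close>

lemma n_atomic_imp_normal:
  fixes a :: "'a::ring_1_no_zero_divisors"
  assumes "n_atomic TYPE('a)"
  shows "normal_elem a"
proof -
  consider "a = 0" | "a \<in> unit_elems" | "a \<in> nonzero_nonunits"
    by (auto simp: nonzero_nonunits_def)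
  then show ?thesis
  proof cases
    case 1
    then show ?thesis by (simp add: normal_elem_def)
  next
    case 2
    then show ?thesis by (rule normal_elem_unit)
  next
    case 3
    then obtain rs where "\<forall>a\<in>set rs. normal_irreducible a" "a = prod_list rs"
      using assms unfolding n_atomic_def by blast
    then show ?thesis
      by (auto simp: normal_irreducible_def intro!: normal_elem_prod_list)
  qed
qed

text \<open>The unit \<open>u\<close> allows \<open>c\<close> to be a unit itself, with
  \<open>cs\<close> empty. This is the form needed for cofactors, which may be units.\<close>

lemma n_atomic_factorization:
  fixes c :: "'a::ring_1_no_zero_divisors"
  assumes "n_atomic TYPE('a)" "c \<noteq> 0"
  obtains u cs where "u \<in> unit_elems" "\<And>a. a \<in> set cs \<Longrightarrow> irreducible_elem a"
    "c = u * prod_list cs"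
proof (cases "c \<in> unit_elems")
  case True
  then show ?thesis
    using that[of c "[]"] by simp
next
  case False
  then have "c \<in> nonzero_nonunits"
    using assms(2) by (simp add: nonzero_nonunits_def)
  then obtain rs where "\<forall>a\<in>set rs. normal_irreducible a" "c = prod_list rs"
    using assms(1) unfolding n_atomic_def by blast
  then show ?thesis
    using that[of 1 rs] by (simp add: normal_irreducible_def)
qed

section \<open>Representatives of irreducible elements\<close>

lemma irreducible_reps_obtain:
  assumes "irreducible_reps R" "irreducible_elem a"
  obtains y u where "y \<in> R" "u \<in> unit_elems" "y = a * u"
proof -
  have "\<exists>!y. y \<in> R \<inter> unit_coset a"
    using assms unfolding irreducible_reps_def by blast
  then show ?thesis
    using that unfolding unit_coset_def by blast
qed

lemma irreducible_reps_irreducible: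
  assumes "irreducible_reps R" "y \<in> R"
  shows "irreducible_elem y"
proof -
  obtain a u where "irreducible_elem a" "u \<in> unit_elems" "y = a * u"
    using assms unfolding irreducible_reps_def unit_coset_def by blast
  then show ?thesis
    by (simp add: irreducible_elem_mult_unit)
qed

text \<open>Property (P). The list may be empty, so that an induction on the number of factors can
  start there.\<close>

definition irreducibles_prime :: "'a::ring_1_no_zero_divisors itself \<Rightarrow> bool" where
  "irreducibles_prime _ \<longleftrightarrow> (\<forall>(t::'a) rs. irreducible_elem t \<longrightarrow> (\<forall>r\<in>set rs. irreducible_elem r) \<longrightarrow>
     divides t (prod_list rs) \<longrightarrow> (\<exists>r\<in>set rs. associated_elems t r))"

text \<open>Property (C), the substitute for commutativity when factors are reordered up to
  units.\<close>

definition irreducibles_commute :: "'a::ring_1_no_zero_divisors itself \<Rightarrow> bool" where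
  "irreducibles_commute _ \<longleftrightarrow> (\<forall>(a::'a) b. irreducible_elem a \<longrightarrow> irreducible_elem b \<longrightarrow>
     associated_elems (a * b) (b * a))"

section \<open>Conjugation in duo domains, where every element is normal\<close>

context
  assumes duo: "\<And>a :: 'a::ring_1_no_zero_divisors. normal_elem a"
begin

lemma mult_commute_right_obtain:
  fixes a d :: 'a
  obtains e where "d * a = a * e"
  using duo[of a] unfolding normal_elem_def by (metis (no_types, lifting) rangeI rangeE)

lemma mult_commute_left_obtain:
  fixes a d :: 'a
  obtains e where "a * d = e * a"
  using duo[of a] unfolding normal_elem_def by (metis (no_types, lifting) rangeI rangeE)

text \<open>For nonzero \<open>a\<close>, the relation \<open>r' * a = a * r\<close> is the graph of
  a ring automorphism, so inverses correspond: \<open>s\<close> is an inverse of \<open>r\<close>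
  exactly when its image \<open>s'\<close> is an inverse of \<open>r'\<close>.\<close>

lemma unit_of_conjugate:
  fixes a :: 'a
  assumes "a \<noteq> 0" "r' * a = a * r"
  shows "r \<in> unit_elems \<longleftrightarrow> r' \<in> unit_elems"
proof
  assume "r \<in> unit_elems"
  then obtain s where s: "r * s = 1" by (rule unit_elems_obtain_inverse)
  obtain s' where "a * s = s' * a" by (rule mult_commute_left_obtain)
  then have "(r' * s') * a = 1 * a"
    using assms(2) s by (metis mult.assoc mult_1_left mult_1_right)
  then have "r' * s' = 1"
    using assms(1) by (simp only: mult_cancel_right) simp
  then show "r' \<in> unit_elems"
    unfolding unit_elems_iff_right by blast
next
  assume "r' \<in> unit_elems"
  then obtain s' where s': "s' * r' = 1" by (rule unit_elems_obtain_inverse)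
  obtain s where "s' * a = a * s" by (rule mult_commute_right_obtain)
  then have "a * (s * r) = a * 1"
    using assms(2) s' by (metis mult.assoc mult_1_left mult_1_right)
  then have "s * r = 1"
    using assms(1) by (simp only: mult_cancel_left) simp
  then show "r \<in> unit_elems"
    unfolding unit_elems_iff_left by blast
qed

text \<open>A factorization of \<open>r'\<close> is carried through \<open>a\<close> to a
  factorization of \<open>r\<close>, and by \<open>unit_of_conjugate\<close> unit factors correspond
  to unit factors.\<close>

lemma irreducible_of_conjugate:
  fixes a :: 'a
  assumes "a \<noteq> 0" "r' * a = a * r" "irreducible_elem r"
  shows "irreducible_elem r'"
proof -
  have "b \<in> unit_elems \<or> c \<in> unit_elems" if "r' = b * c" for b c
  proof -
    obtain b' where b': "b * a = a * b'" by (rule mult_commute_right_obtain)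
    obtain c' where c': "c * a = a * c'" by (rule mult_commute_right_obtain)
    have "a * r = a * (b' * c')"
      using assms(2) that b' c' by (metis mult.assoc)
    then have "r = b' * c'"
      using assms(1) by simp
    then have "b' \<in> unit_elems \<or> c' \<in> unit_elems"
      using assms(3) unfolding irreducible_elem_def by blast
    then show ?thesis
      using unit_of_conjugate[OF assms(1)] b' c' by blast
  qed
  moreover have "r' \<noteq> 0"
    using assms by (auto simp: irreducible_elem_def)
  moreover have "r' \<notin> unit_elems"
    using assms unit_of_conjugate[OF assms(1,2)] by (simp add: irreducible_elem_def)
  ultimately show ?thesis
    unfolding irreducible_elem_def by blast
qed

text \<open>This serves to collect all unit factors on the right.\<close>

lemma unit_mult_commute:
  fixes a u :: 'a
  assumes "u \<in> unit_elems"
  obtains v where "v \<in> unit_elems" "u * a = a * v"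
proof (cases "a = 0")
  case True
  \<comment> \<open>Conjugation by 0 determines nothing; any unit serves, and 1 is taken.\<close>
  then show ?thesis using that[of 1] by simp
next
  case False
  obtain v where v: "u * a = a * v" by (rule mult_commute_right_obtain)
  show ?thesis
    using that[OF _ v] unit_of_conjugate[OF False v] assms by simp
qed

section \<open>Association and divisibility\<close>

lemma associated_elems_iff:
  fixes a b :: 'a
  shows "associated_elems a b \<longleftrightarrow> (\<exists>u\<in>unit_elems. a = b * u)"
proof
  assume "associated_elems a b"
  then obtain u v where "u \<in> unit_elems" "v \<in> unit_elems" "a = v * b * u"
    unfolding associated_elems_def by blast
  moreover obtain w where "w \<in> unit_elems" "v * b = b * w"
    using \<open>v \<in> unit_elems\<close> by (rule unit_mult_commute)
  ultimately have "a = b * (w * u)" "w * u \<in> unit_elems"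
    by (simp_all add: mult.assoc)
  then show "\<exists>u\<in>unit_elems. a = b * u" by blast
next
  assume "\<exists>u\<in>unit_elems. a = b * u"
  then show "associated_elems a b"
    unfolding associated_elems_def by (metis mult_1_left one_in_unit_elems)
qed

lemma associated_elems_refl [simp]: "associated_elems (a :: 'a) a"
  unfolding associated_elems_iff by (metis mult_1_right one_in_unit_elems)

lemma associated_elems_sym:
  fixes a b :: 'a
  assumes "associated_elems a b"
  shows "associated_elems b a"
proof -
  obtain u where u: "u \<in> unit_elems" "a = b * u"
    using assms unfolding associated_elems_iff by blast
  obtain v where "v \<in> unit_elems" "u * v = 1"
    using u(1) by (rule unit_elems_obtain_inverse)
  with u show ?thesis
    unfolding associated_elems_iff by (metis mult.assoc mult_1_right)
qed

lemma associated_elems_trans [trans]: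
  fixes a b c :: 'a
  assumes "associated_elems a b" "associated_elems b c"
  shows "associated_elems a c"
  using assms unfolding associated_elems_iff by (metis mult.assoc mult_in_unit_elems_iff)

lemma associated_elems_mult:
  fixes a b c d :: 'a
  assumes "associated_elems a b" "associated_elems c d"
  shows "associated_elems (a * c) (b * d)"
proof -
  obtain u w where u: "u \<in> unit_elems" "a = b * u" and w: "w \<in> unit_elems" "c = d * w"
    using assms unfolding associated_elems_iff by blast
  obtain v where "v \<in> unit_elems" "u * d = d * v"
    using u(1) by (rule unit_mult_commute)
  with u w have "a * c = (b * d) * (v * w)" "v * w \<in> unit_elems"
    by (simp_all) (metis mult.assoc)
  then show ?thesis
    unfolding associated_elems_iff by blast
qed

lemma associated_elems_cancel_left:
  fixes a b c :: 'a
  assumes "associated_elems (a * b) (a * c)" "a \<noteq> 0"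
  shows "associated_elems b c"
  using assms unfolding associated_elems_iff by (simp add: mult.assoc)

lemma divides_iff:
  fixes a b :: 'a
  shows "divides a b \<longleftrightarrow> (\<exists>c. b = a * c)"
proof
  assume "divides a b"
  then obtain c d where "b = c * a * d"
    unfolding divides_def by blast
  \<comment> \<open>Normality of \<open>a\<close> moves the left cofactor to the right.\<close>
  moreover obtain e where "c * a = a * e"
    by (rule mult_commute_right_obtain)
  ultimately show "\<exists>c. b = a * c"
    by (metis mult.assoc)
next
  assume "\<exists>c. b = a * c"
  then show "divides a b"
    unfolding divides_def by (metis mult_1_left)
qed

lemma divides_associated:
  fixes a b x y :: 'a
  assumes "associated_elems a b" "associated_elems x y" "divides a x"
  shows "divides b y"
proof -
  obtain u c where u: "a = b * u" "x = a * c"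
    using assms(1,3) unfolding associated_elems_iff divides_iff by blast
  obtain v where "y = x * v"
    using associated_elems_sym[OF assms(2)] unfolding associated_elems_iff by blast
  with u have "y = b * (u * c * v)"
    by (simp add: mult.assoc)
  then show ?thesis
    unfolding divides_iff by blast
qed

lemma divides_mult_cancel_left:
  fixes a b c :: 'a
  assumes "divides (a * b) (a * c)" "a \<noteq> 0"
  shows "divides b c"
  using assms unfolding divides_iff by (simp add: mult.assoc)

lemma divides_mult_mono_left:
  fixes a b c :: 'a
  assumes "divides b c"
  shows "divides (a * b) (a * c)"
  using assms unfolding divides_iff by (auto simp: mult.assoc)

lemma divides_prod_list:
  fixes rs :: "'a list"
  assumes "r \<in> set rs"
  shows "divides r (prod_list rs)"
proof -
  obtain xs ys where "rs = xs @ r # ys"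
    using assms by (meson split_list)
  then have "prod_list rs = prod_list xs * r * prod_list ys"
    by (simp add: mult.assoc)
  then show ?thesis
    unfolding divides_def by blast
qed

text \<open>The association classes of irreducibles are the cosets \<open>unit_coset a\<close>, and
  \<open>R\<close> contains exactly one element of each.\<close>

lemma irreducible_reps_associated_eq:
  fixes R :: "'a set"
  assumes "irreducible_reps R" "y \<in> R" "z \<in> R" "associated_elems y z"
  shows "y = z"
proof -
  have "irreducible_elem z"
    using assms irreducible_reps_irreducible by blast
  moreover have "y \<in> unit_coset z"
    using assms(4) unfolding associated_elems_iff unit_coset_def by blast
  moreover have "z \<in> unit_coset z"
    unfolding unit_coset_def by (metis imageI mult_1_right one_in_unit_elems)
  ultimately show ?thesis
    using assms(1-3) unfolding irreducible_reps_def by blast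
qed

section \<open>Properties (P) and (C), and factorizations under them\<close>

lemma irreducibles_commuteI:
  assumes "\<And>a r r' :: 'a. \<lbrakk>irreducible_elem a; irreducible_elem r; irreducible_elem r';
    a * r = r' * a\<rbrakk> \<Longrightarrow> associated_elems r r' \<or> associated_elems r a"
  shows "irreducibles_commute TYPE('a)"
  unfolding irreducibles_commute_def
proof (intro allI impI)
  fix a r :: 'a
  assume a: "irreducible_elem a" and r: "irreducible_elem r"
  obtain r' where r': "a * r = r' * a"
    by (rule mult_commute_left_obtain)
  have "irreducible_elem r'"
    using irreducible_of_conjugate[OF irreducible_elem_nonzero[OF a] _ r] r' by simp
  \<comment> \<open>The commutation hypothesis of the theorem supplies the first alternative. Under
    (P) the second may occur instead, and then the two products have pairwise associated
    factors.\<close>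
  from assms[OF a r this r'] show "associated_elems (a * r) (r * a)"
  proof
    assume "associated_elems r r'"
    then show ?thesis
      unfolding r' using associated_elems_mult associated_elems_refl associated_elems_sym by blast
  next
    assume "associated_elems r a"
    then show ?thesis
      using associated_elems_mult associated_elems_sym by blast
  qed
qed

lemma irreducibles_prime_imp_commute:
  assumes "irreducibles_prime TYPE('a)"
  shows "irreducibles_commute TYPE('a)"
proof (rule irreducibles_commuteI)
  fix a r r' :: 'a
  assume irr: "irreducible_elem a" "irreducible_elem r" "irreducible_elem r'"
    and eq: "a * r = r' * a"
  \<comment> \<open>The left cofactor is \<open>a\<close> and the right one is 1.\<close>
  have "divides r (prod_list [r', a])"
    using eq unfolding divides_def by (metis mult_1_right prod_list.Cons prod_list.Nil)
  then have "\<exists>s\<in>set [r', a]. associated_elems r s"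
    using assms irr unfolding irreducibles_prime_def
    by (metis empty_iff insert_iff list.set)
  then show "associated_elems r r' \<or> associated_elems r a"
    by auto
qed

text \<open>Property (C) is applied once for each factor of \<open>xs\<close> that \<open>r\<close>
  passes.\<close>

lemma prod_list_move_to_front:
  fixes r :: 'a
  assumes "irreducibles_commute TYPE('a)" "irreducible_elem r" "\<And>a. a \<in> set xs \<Longrightarrow> irreducible_elem a"
  shows "associated_elems (prod_list (xs @ r # ys)) (r * prod_list (xs @ ys))"
  using assms(3)
proof (induction xs)
  case (Cons x xs)
  have "associated_elems (x * prod_list (xs @ r # ys)) (x * (r * prod_list (xs @ ys)))"
    using Cons by (intro associated_elems_mult) auto
  also have "associated_elems \<dots> (r * x * prod_list (xs @ ys))"
    using assms(1,2) Cons.prems unfolding irreducibles_commute_def mult.assoc[symmetric]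
    by (intro associated_elems_mult[OF _ associated_elems_refl]) auto
  finally show ?case
    by (simp add: mult.assoc)
qed simp

text \<open>A factor \<open>r\<close> associated with the head \<open>y\<close> is brought to the
  front and removed from \<open>rs\<close>. The other elements of \<open>ys\<close> keep their
  partners: sharing \<open>r\<close> with \<open>y\<close> would make them associated with
  \<open>y\<close>, hence equal to it, against distinctness.\<close>

lemma prod_list_divides_prod_list:
  fixes ys rs :: "'a list"
  assumes "irreducibles_commute TYPE('a)"
    and "\<And>r. r \<in> set rs \<Longrightarrow> irreducible_elem r"
    and "\<And>y. y \<in> set ys \<Longrightarrow> \<exists>r\<in>set rs. associated_elems y r"
    and "distinct ys"
    and "\<And>y z. \<lbrakk>y \<in> set ys; z \<in> set ys; associated_elems y z\<rbrakk> \<Longrightarrow> y = z"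
  shows "divides (prod_list ys) (prod_list rs)"
  using assms(2-)
proof (induction ys arbitrary: rs)
  case Nil
  then show ?case by (simp add: divides_iff)
next
  case (Cons y ys)
  obtain r where r: "r \<in> set rs" "associated_elems y r"
    using Cons.prems(2) by (meson list.set_intros(1))
  obtain us vs where rs: "rs = us @ r # vs"
    using r(1) by (meson split_list)
  have "divides (prod_list ys) (prod_list (us @ vs))"
  proof (rule Cons.IH)
    fix z assume z: "z \<in> set ys"
    obtain s where s: "s \<in> set rs" "associated_elems z s"
      using Cons.prems(2) z by (meson list.set_intros(2))
    have "s \<noteq> r"
    proof
      assume "s = r"
      then have "associated_elems y z"
        using r s by (meson associated_elems_sym associated_elems_trans)
      then show False
        using Cons.prems(3) Cons.prems(4)[of y z] z by auto
    qed
    with s show "\<exists>r\<in>set (us @ vs). associated_elems z r"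
      unfolding rs by auto
  qed (use Cons.prems rs in auto)
  then have "divides (y * prod_list ys) (y * prod_list (us @ vs))"
    by (rule divides_mult_mono_left)
  moreover have "associated_elems (y * prod_list (us @ vs)) (prod_list rs)"
  proof -
    have "associated_elems (y * prod_list (us @ vs)) (r * prod_list (us @ vs))"
      using r by (intro associated_elems_mult) auto
    also have "associated_elems \<dots> (prod_list rs)"
      unfolding rs using Cons.prems(1) rs
      by (intro associated_elems_sym[OF prod_list_move_to_front[OF assms(1)]]) auto
    finally show ?thesis .
  qed
  ultimately show ?case
    using divides_associated[OF associated_elems_refl] by simp
qed

lemma factorization_unique:
  fixes rs ts :: "'a list"
  assumes "irreducibles_prime TYPE('a)"
    and "\<And>r. r \<in> set rs \<Longrightarrow> irreducible_elem r"
    and "\<And>t. t \<in> set ts \<Longrightarrow> irreducible_elem t"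
    and "associated_elems (prod_list rs) (prod_list ts)"
  shows "rel_mset associated_elems (mset rs) (mset ts)"
  using assms(2-)
proof (induction rs arbitrary: ts)
  case Nil
  have "ts = []"
  proof (rule ccontr)
    assume "ts \<noteq> []"
    then obtain t us where ts: "ts = t # us"
      by (cases ts) auto
    \<comment> \<open>The product is associated with the empty product 1, so every factor would be a
      unit.\<close>
    have "prod_list ts \<in> unit_elems"
      using associated_elems_sym[OF Nil.prems(3)] unfolding associated_elems_iff by auto
    then have "t \<in> unit_elems"
      using ts by simp
    then show False
      using Nil.prems(2)[of t] ts by (simp add: irreducible_elem_def)
  qed
  then show ?case
    by (simp add: rel_mset_Zero)
next
  case (Cons r rs)
  have C: "irreducibles_commute TYPE('a)"
    using assms(1) by (rule irreducibles_prime_imp_commute)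
  have r: "irreducible_elem r"
    using Cons.prems(1) by simp
  have "divides r (prod_list ts)"
    using divides_associated[OF associated_elems_refl Cons.prems(3)] divides_prod_list[of r "r # rs"]
    by simp
  then obtain t where t: "t \<in> set ts" "associated_elems r t"
    using assms(1) r Cons.prems(2) unfolding irreducibles_prime_def by blast
  obtain us vs where ts: "ts = us @ t # vs"
    using t(1) by (meson split_list)
  have "associated_elems (r * prod_list rs) (prod_list ts)"
    using Cons.prems(3) by simp
  also have "associated_elems \<dots> (t * prod_list (us @ vs))"
    unfolding ts using Cons.prems(2) ts by (intro prod_list_move_to_front[OF C]) auto
  \<comment> \<open>Replacing \<open>t\<close> with \<open>r\<close> gives both sides the same first
    factor, which is then cancelled. The products of the remaining factors are only associated,
    hence association rather than equality in the induction.\<close>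
  also have "associated_elems \<dots> (r * prod_list (us @ vs))"
    using t(2) associated_elems_mult associated_elems_refl associated_elems_sym by blast
  finally have "associated_elems (prod_list rs) (prod_list (us @ vs))"
    using associated_elems_cancel_left irreducible_elem_nonzero[OF r] by blast
  then have "rel_mset associated_elems (mset rs) (mset (us @ vs))"
    using Cons.prems ts by (intro Cons.IH) auto
  then have "rel_mset associated_elems (add_mset r (mset rs)) (add_mset t (mset (us @ vs)))"
    using t(2) by (intro rel_mset_Plus)
  then show ?case
    using ts by simp
qed

section \<open>Equivalence of the n-UFD condition with (P) in the n-atomic case\<close>

lemma n_UFD_if_irreducibles_prime:
  assumes "n_atomic TYPE('a)" "irreducibles_prime TYPE('a)"
  shows "n_UFD TYPE('a)"
  unfolding n_UFD_def
proof (intro conjI allI impI assms(1); elim conjE)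
  fix rs ts :: "'a list"
  assume irr: "\<forall>a\<in>set rs. normal_irreducible a" "\<forall>a\<in>set ts. normal_irreducible a"
    and eq: "prod_list rs = prod_list ts"
  have "rel_mset associated_elems (mset rs) (mset ts)"
    using assms(2) irr eq
    by (intro factorization_unique) (auto simp: normal_irreducible_def)
  then obtain xs ys where "mset xs = mset rs" "mset ys = mset ts" "list_all2 associated_elems xs ys"
    unfolding rel_mset_def by blast
  \<comment> \<open>The pairing of multisets is rearranged so that \<open>rs\<close> keeps its
    order; only \<open>ts\<close> is permuted.\<close>
  then obtain zs where zs: "list_all2 associated_elems rs zs" "mset zs = mset ts"
    by (metis list_all2_reorder_left_invariance)
  obtain \<sigma> where \<sigma>: "\<sigma> permutes {..<length ts}" "permute_list \<sigma> ts = zs"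
    using zs(2) by (rule mset_eq_permutation)
  show len: "length rs = length ts"
    using zs by (metis list_all2_lengthD mset_eq_length)
  have "associated_elems (rs ! i) (ts ! \<sigma> i)" if "i < length rs" for i
    using list_all2_nthD[OF zs(1) that] that len \<sigma> permute_list_nth by metis
  with \<sigma>(1) len show "\<exists>\<sigma>. \<sigma> permutes {..<length rs} \<and>
      (\<forall>i<length rs. associated_elems (rs ! i) (ts ! \<sigma> i))"
    by auto
qed

text \<open>Putting \<open>t\<close> before a factorization of its cofactor gives a second
  factorization of \<open>prod_list rs\<close>, and uniqueness matches \<open>t\<close> with an
  entry of \<open>rs\<close>.\<close>

lemma irreducibles_prime_if_n_UFD:
  assumes "n_UFD TYPE('a)"
  shows "irreducibles_prime TYPE('a)"
  unfolding irreducibles_prime_def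
proof (intro allI impI)
  fix t :: 'a and rs
  assume t: "irreducible_elem t" and rs: "\<forall>r\<in>set rs. irreducible_elem r"
    and "divides t (prod_list rs)"
  then obtain c where c: "prod_list rs = t * c"
    unfolding divides_iff by blast
  have nz: "prod_list rs \<noteq> 0"
    using rs prod_list_irreducible_nonzero by blast
  have "n_atomic TYPE('a)" "c \<noteq> 0"
    using assms c nz by (auto simp: n_UFD_def)
  then obtain u cs where u: "u \<in> unit_elems" and cs: "\<And>a. a \<in> set cs \<Longrightarrow> irreducible_elem a"
    and ccs: "c = u * prod_list cs"
    using n_atomic_factorization by blast
  \<comment> \<open>The unit is absorbed into the first factor, so \<open>t\<close> is represented
    at index 0.\<close>
  have eq: "prod_list (t * u # cs) = prod_list rs"
    by (simp add: c ccs mult.assoc)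
  have "prod_list rs \<notin> unit_elems"
    using t unfolding c by (simp add: irreducible_elem_def)
  with nz have "prod_list (t * u # cs) \<in> nonzero_nonunits"
    unfolding eq by (simp add: nonzero_nonunits_def)
  moreover have "\<forall>a\<in>set (t * u # cs). normal_irreducible a"
    using cs irreducible_elem_mult_unit[OF t u] duo by (auto simp: normal_irreducible_def)
  moreover have "\<forall>a\<in>set rs. normal_irreducible a"
    using rs duo by (auto simp: normal_irreducible_def)
  ultimately obtain \<sigma> where len: "length (t * u # cs) = length rs"
    and \<sigma>: "\<sigma> permutes {..<length (t * u # cs)}"
    and ass: "\<And>i. i < length (t * u # cs) \<Longrightarrow> associated_elems ((t * u # cs) ! i) (rs ! \<sigma> i)"
    using assms eq unfolding n_UFD_def by blast
  have "associated_elems t (t * u)"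
    using u associated_elems_iff associated_elems_sym by blast
  also have "associated_elems (t * u) (rs ! \<sigma> 0)"
    using ass[of 0] by simp
  finally have "associated_elems t (rs ! \<sigma> 0)" .
  moreover have "\<sigma> 0 < length rs"
    using permutes_in_image[OF \<sigma>, of 0] len by auto
  ultimately show "\<exists>r\<in>set rs. associated_elems t r"
    by auto
qed

section \<open>Divisor complexes and (P)\<close>

lemma complex_is_simplex_if_irreducibles_prime:
  fixes R :: "'a set"
  assumes reps: "irreducible_reps R" and prime: "irreducibles_prime TYPE('a)"
    and rs: "\<And>r. r \<in> set rs \<Longrightarrow> irreducible_elem r"
  defines "A \<equiv> irreducible_divisors R (prod_list rs)"
  shows "irreducible_divisor_complex R (prod_list rs) = (A, Pow A)"
proof -
  have irr: "irreducible_elem y" if "y \<in> A" for y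
    using that reps irreducible_reps_irreducible by (auto simp: A_def irreducible_divisors_def)
  have "\<exists>r\<in>set rs. associated_elems y r" if "y \<in> A" for y
    using prime irr[OF that] rs that
    unfolding irreducibles_prime_def A_def irreducible_divisors_def by blast
  then obtain f where f: "\<And>y. y \<in> A \<Longrightarrow> f y \<in> set rs \<and> associated_elems y (f y)"
    by metis
  have eq: "y = z" if "y \<in> A" "z \<in> A" "associated_elems y z" for y z
    using that irreducible_reps_associated_eq[OF reps]
    by (auto simp: A_def irreducible_divisors_def)
  \<comment> \<open>Vertices sharing a partner are associated, hence equal. Thus \<open>A\<close>
    embeds into the factors of a single factorization and is finite, which allows its subsets to be
    listed.\<close>
  have "inj_on f A"
    by (rule inj_onI) (metis f eq associated_elems_sym associated_elems_trans)
  moreover have "f ` A \<subseteq> set rs"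
    using f by blast
  ultimately have fin: "finite A"
    by (metis finite_imageD finite_set finite_subset)
  have "\<exists>ys. B = set ys \<and> distinct ys \<and> set ys \<subseteq> A \<and>
      (\<exists>\<sigma>. \<sigma> permutes {..<length ys} \<and> divides (prod_list (permute_list \<sigma> ys)) (prod_list rs))"
    if B: "B \<subseteq> A" for B
  proof -
    obtain ys where ys: "set ys = B" "distinct ys"
      using finite_distinct_list[OF finite_subset[OF B fin]] by blast
    have "divides (prod_list ys) (prod_list rs)"
      using ys B f eq
      by (intro prod_list_divides_prod_list irreducibles_prime_imp_commute prime rs) blast+
    \<comment> \<open>The vertices can be multiplied in any order, so the identity permutation is a
      witness.\<close>
    then have "divides (prod_list (permute_list id ys)) (prod_list rs)"
      by simp
    then show ?thesis
      using ys B permutes_id by blast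
  qed
  then show ?thesis
    unfolding irreducible_divisor_complex_def A_def[symmetric] by auto
qed

text \<open>Faces with two vertices suffice: they allow the head of the list to be cancelled
  whenever \<open>t\<close> is not associated with it.\<close>

lemma irreducibles_prime_if_complex_is_simplex:
  fixes R :: "'a set"
  assumes reps: "irreducible_reps R" and comm: "irreducibles_commute TYPE('a)"
    and simplex: "\<And>x :: 'a. x \<in> nonzero_nonunits \<Longrightarrow> \<exists>A\<subseteq>irreducible_divisors R x.
      irreducible_divisor_complex R x = (A, Pow A)"
  shows "irreducibles_prime TYPE('a)"
  unfolding irreducibles_prime_def
proof (intro allI impI)
  fix t :: 'a and rs
  assume t: "irreducible_elem t" and "\<forall>r\<in>set rs. irreducible_elem r" and "divides t (prod_list rs)"
  then show "\<exists>r\<in>set rs. associated_elems t r"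
  proof (induction rs)
    case Nil
    then obtain c where "t * c = 1"
      unfolding divides_iff by auto
    then show ?case
      using t unfolding irreducible_elem_def unit_elems_iff_right by blast
  next
    case (Cons r rs)
    show ?case
    proof (cases "associated_elems t r")
      case True
      then show ?thesis by simp
    next
      case False
      define x where "x = prod_list (r # rs)"
      have r: "irreducible_elem r"
        using Cons.prems by simp
      have "x \<noteq> 0"
        unfolding x_def using Cons.prems by (intro prod_list_irreducible_nonzero) auto
      moreover have "x \<notin> unit_elems"
        using r by (simp add: x_def irreducible_elem_def)
      ultimately have x: "x \<in> nonzero_nonunits"
        by (simp add: nonzero_nonunits_def)
      obtain y where y: "y \<in> R" "associated_elems y r"
        using irreducible_reps_obtain[OF reps r] associated_elems_iff by metis
      obtain z where z: "z \<in> R" "associated_elems z t"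
        using irreducible_reps_obtain[OF reps t] associated_elems_iff by metis
      have "y \<noteq> z"
        using False y z by (meson associated_elems_sym associated_elems_trans)
      have "divides y x"
        using divides_associated[OF associated_elems_sym[OF y(2)] associated_elems_refl]
          divides_prod_list[of r "r # rs"] by (simp add: x_def)
      moreover have "divides z x"
        using divides_associated[OF associated_elems_sym[OF z(2)] associated_elems_refl]
          Cons.prems by (simp add: x_def)
      ultimately have "{y, z} \<in> Pow (irreducible_divisors R x)"
        using y z by (simp add: irreducible_divisors_def)
      \<comment> \<open>The first component of the complex is the full vertex set, so the
        \<open>A\<close> of the hypothesis must be that set.\<close>
      also have "Pow (irreducible_divisors R x) = snd (irreducible_divisor_complex R x)"
        using simplex[OF x] by (auto simp: irreducible_divisor_complex_def)
      finally obtain ys \<sigma> where ys: "{y, z} = set ys" "distinct ys"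
        and \<sigma>: "\<sigma> permutes {..<length ys}" and dvd: "divides (prod_list (permute_list \<sigma> ys)) x"
        unfolding irreducible_divisor_complex_def by auto
      define ws where "ws = permute_list \<sigma> ys"
      have ws: "set ws = {y, z}" "distinct ws"
        unfolding ws_def using ys \<sigma> by (simp_all add: set_permute_list)
      have "length ws = 2"
        using ws \<open>y \<noteq> z\<close> distinct_card[of ws] by simp
      then obtain a b where "ws = [a, b]"
        by (auto simp: length_Suc_conv numeral_2_eq_2)
      \<comment> \<open>A face guarantees divisibility for some order of its vertices only; the
        unwanted order is repaired by (C).\<close>
      with ws have "ws = [y, z] \<or> ws = [z, y]"
        by (auto simp: doubleton_eq_iff)
      then have "associated_elems (prod_list ws) (r * t)"
      proof
        assume "ws = [y, z]"
        then show ?thesis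
          using y z by (simp add: associated_elems_mult)
      next
        assume ws: "ws = [z, y]"
        have "associated_elems (z * y) (t * r)"
          using y z by (simp add: associated_elems_mult)
        also have "associated_elems \<dots> (r * t)"
          using comm r t unfolding irreducibles_commute_def by blast
        finally show ?thesis
          by (simp add: ws)
      qed
      then have "divides (r * t) (r * prod_list rs)"
        using divides_associated[OF _ associated_elems_refl] dvd by (simp add: ws_def x_def)
      then have "divides t (prod_list rs)"
        using divides_mult_cancel_left irreducible_elem_nonzero[OF r] by blast
      then show ?thesis
        using Cons by auto
    qed
  qed
qed

end

theorem theorem9:
  fixes R :: "'a::ring_1_no_zero_divisors set"
  assumes reps: "irreducible_reps R"
    and atomic: "n_atomic TYPE('a)"
  shows "(n_UFD TYPE('a) \<longrightarrow>
            (\<forall>x\<in>nonzero_nonunits. \<exists>A\<subseteq>irreducible_divisors R x.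
               irreducible_divisor_complex R x = (A, Pow A)))
       \<and> ((\<forall>a r r' :: 'a. normal_irreducible a \<and> normal_irreducible r \<and> normal_irreducible r' \<and>
              a * r = r' * a \<longrightarrow> associated_elems r r') \<longrightarrow>
            (\<forall>x\<in>nonzero_nonunits. \<exists>A\<subseteq>irreducible_divisors R x.
               irreducible_divisor_complex R x = (A, Pow A)) \<longrightarrow>
            n_UFD TYPE('a))"
proof (intro conjI impI ballI)
  have duo: "normal_elem a" for a :: 'a
    using atomic by (rule n_atomic_imp_normal)
  show "\<exists>A\<subseteq>irreducible_divisors R x. irreducible_divisor_complex R x = (A, Pow A)"
    if ufd: "n_UFD TYPE('a)" and x: "x \<in> nonzero_nonunits" for x
  proof -
    obtain rs where "\<forall>a\<in>set rs. normal_irreducible a" "x = prod_list rs"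
      using atomic x unfolding n_atomic_def by blast
    then show ?thesis
      using complex_is_simplex_if_irreducibles_prime[OF duo reps irreducibles_prime_if_n_UFD[OF duo ufd]]
      by (auto simp: normal_irreducible_def)
  qed
  assume "\<forall>a r r' :: 'a. normal_irreducible a \<and> normal_irreducible r \<and> normal_irreducible r' \<and>
      a * r = r' * a \<longrightarrow> associated_elems r r'"
  \<comment> \<open>As every element is normal, the hypothesis applies to all irreducibles,
    including the conjugate \<open>r'\<close>.\<close>
  then have "irreducibles_commute TYPE('a)"
    using duo by (intro irreducibles_commuteI) (auto simp: normal_irreducible_def)
  moreover assume "\<forall>x\<in>nonzero_nonunits. \<exists>A\<subseteq>irreducible_divisors R x.
      irreducible_divisor_complex R x = (A, Pow A)"
  ultimately show "n_UFD TYPE('a)"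
    using duo atomic reps
    by (intro n_UFD_if_irreducibles_prime irreducibles_prime_if_complex_is_simplex[of R]) auto
qed

end
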